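(* Let $(X,T)$ be a transitive locally compact two-sided topological Markov shift over a countably infinite set of states $S$, let $\lambda>0$, and let $\phi:X^+\to\mathbb{R}$ be a $\lambda$-transient potential function with summable variations. Then there exists a positive continuous $\lambda$-eigenfunction, i.e. a continuous function $h:X^+\to(0,\infty)$ with $L_\phi h=\lambda h$.
   Context: Let $S$ be a countably infinite set and $\mathbb{A}\in\{0,1\}^{S\times S}$. $X=\{z\in S^{\mathbb{Z}}:\mathbb{A}_{(z)_i,(z)_{i+1}}=1\ \forall i\in\mathbb{Z}\}$ with left shift $T$ is the two-sided topological Markov shift, and $X^+=\{x\in S^{\{0,1,2,\dots\}}:\mathbb{A}_{(x)_i,(x)_{i+1}}=1\ \forall i\ge0\}$, with $(Tx)_i=(x)_{i+1}$ and metric $d(x,y)=2^{-\inf\{i\ge0:(x)_i\ne(y)_i\}}$, is the associated one-sided shift. Transitive: for all $a,b\in S$ there is a finite path $a=a_0,\dots,a_n=b$, $n\ge1$, with $\mathbb{A}_{a_i,a_{i+1}}=1$. Locally compact (two-sided): $\sum_b\mathbb{A}_{a,b}+\sum_b\mathbb{A}_{b,a}<\infty$ for all $a\in S$. For $\phi:X^+\to\mathbb{R}$, $Var_m(\phi)=\sup\{|\phi(x)-\phi(y)|:(x)_i=(y)_i,\ 0\le i\le m-1\}$; summable variations means $\sum_{m\ge2}Var_m(\phi)<\infty$. Ruelle operator: $(L_\phi f)(x)=\sum_{y:Ty=x}e^{\phi(y)}f(y)$. $\phi$ is $\lambda$-transient if $\sum_{n\ge0}\lambda^{-n}(L_\phi^nf)(x)<\infty$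 for every (equivalently, some) nonzero non-negative compactly supported continuous $f$ on $X^+$ and $x\in X^+$. *)

theory Defs
  imports "HOL-Analysis.Analysis"
begin

text \<open>
  The state space is the universe of the type \<open>'s\<close>. The two-sided shift \<open>X\<close>, the set of
  all \<open>z :: int \<Rightarrow> 's\<close> with \<open>A (z i) (z (i + 1)) = 1\<close> for every \<open>i\<close>, is determined by its transition
  matrix \<open>A\<close>. Its transitivity and its local compactness are by definition conditions on \<open>A\<close>, so
  the predicates below are stated for the matrix.
\<close>

definition transition_matrix :: "('s \<Rightarrow> 's \<Rightarrow> nat) \<Rightarrow> bool" where
  "transition_matrix A \<longleftrightarrow> (\<forall>a b. A a b \<in> {0, 1})"

definition one_sided_shift :: "('s \<Rightarrow> 's \<Rightarrow> nat) \<Rightarrow> (nat \<Rightarrow> 's) set" where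
  "one_sided_shift A = {x. \<forall>i. A (x i) (x (Suc i)) = 1}"

definition left_shift :: "(nat \<Rightarrow> 's) \<Rightarrow> nat \<Rightarrow> 's" where
  "left_shift x = (\<lambda>i. x (Suc i))"

definition transitive_matrix :: "('s \<Rightarrow> 's \<Rightarrow> nat) \<Rightarrow> bool" where
  "transitive_matrix A \<longleftrightarrow>
     (\<forall>a b. \<exists>n\<ge>1. \<exists>p :: nat \<Rightarrow> 's. p 0 = a \<and> p n = b \<and> (\<forall>i<n. A (p i) (p (Suc i)) = 1))"

definition locally_compact_matrix :: "('s \<Rightarrow> 's \<Rightarrow> nat) \<Rightarrow> bool" where
  "locally_compact_matrix A \<longleftrightarrow>
     (\<forall>a. (\<Sum>\<^sub>\<infinity>b. (of_nat (A a b) :: ennreal)) + (\<Sum>\<^sub>\<infinity>b. of_nat (A b a)) < \<infinity>)"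

text \<open>The case \<open>x = y\<close> is the convention that the infimum of the empty set is infinite.\<close>

definition shift_dist :: "(nat \<Rightarrow> 's) \<Rightarrow> (nat \<Rightarrow> 's) \<Rightarrow> real" where
  "shift_dist x y = (if x = y then 0 else (1 / 2) ^ (LEAST i. x i \<noteq> y i))"

lemma shift_dist_less_iff:
  "shift_dist x y < (1 / 2) ^ n \<longleftrightarrow> (\<forall>i\<le>n. x i = y i)"
proof (cases "x = y")
  case False
  define k where "k = (LEAST i. x i \<noteq> y i)"
  from False obtain j where "x j \<noteq> y j" by auto
  then have k: "x k \<noteq> y k" unfolding k_def by (rule LeastI)
  have less: "x i = y i" if "i < k" for i
    using not_less_Least[of i "\<lambda>i. x i \<noteq> y i"] that unfolding k_def by blast
  have "shift_dist x y < (1 / 2) ^ n \<longleftrightarrow> n < k"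
    using False by (simp add: shift_dist_def k_def power_strict_decreasing_iff)
  also have "\<dots> \<longleftrightarrow> (\<forall>i\<le>n. x i = y i)"
    using k less by (metis le_less_trans not_le)
  finally show ?thesis .
qed (simp add: shift_dist_def)

lemma Metric_space_shift_dist: "Metric_space M shift_dist"
proof
  show "0 \<le> shift_dist x y" for x y :: "nat \<Rightarrow> 's" by (simp add: shift_dist_def)
  show "shift_dist x y = shift_dist y x" for x y :: "nat \<Rightarrow> 's"
    by (simp add: shift_dist_def eq_commute)
  show "shift_dist x y = 0 \<longleftrightarrow> x = y" for x y :: "nat \<Rightarrow> 's"
    by (simp add: shift_dist_def)
  show "shift_dist x z \<le> shift_dist x y + shift_dist y z" for x y z :: "nat \<Rightarrow> 's"
  proof (cases "x = z")
    case False
    define n where "n = (LEAST i. x i \<noteq> z i)"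
    have xz: "shift_dist x z = (1 / 2) ^ n" using False by (simp add: shift_dist_def n_def)
    have "\<not> (\<forall>i\<le>n. x i = z i)" using shift_dist_less_iff[of x z n] xz by simp
    then have "\<not> (\<forall>i\<le>n. x i = y i) \<or> \<not> (\<forall>i\<le>n. y i = z i)" by auto
    then have "(1 / 2) ^ n \<le> shift_dist x y \<or> (1 / 2) ^ n \<le> shift_dist y z"
      by (meson not_le shift_dist_less_iff)
    moreover have "0 \<le> shift_dist x y" "0 \<le> shift_dist y z" by (simp_all add: shift_dist_def)
    ultimately show ?thesis using xz by linarith
  qed (simp add: shift_dist_def)
qed

definition shift_topology :: "('s \<Rightarrow> 's \<Rightarrow> nat) \<Rightarrow> (nat \<Rightarrow> 's) topology" where
  "shift_topology A = Metric_space.mtopology (one_sided_shift A) shift_dist"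

lemma topspace_shift_topology [simp]: "topspace (shift_topology A) = one_sided_shift A"
  unfolding shift_topology_def
  by (rule Metric_space.topspace_mtopology[OF Metric_space_shift_dist])

text \<open>
  A function on the one-sided shift is a function on all sequences of which only the
  values on \<open>one_sided_shift A\<close> are used.
\<close>

definition variation :: "('s \<Rightarrow> 's \<Rightarrow> nat) \<Rightarrow> ((nat \<Rightarrow> 's) \<Rightarrow> real) \<Rightarrow> nat \<Rightarrow> ennreal" where
  "variation A \<phi> m =
     Sup {ennreal \<bar>\<phi> x - \<phi> y\<bar> | x y.
            x \<in> one_sided_shift A \<and> y \<in> one_sided_shift A \<and> (\<forall>i<m. x i = y i)}"

definition summable_variations :: "('s \<Rightarrow> 's \<Rightarrow> nat) \<Rightarrow> ((nat \<Rightarrow> 's) \<Rightarrow> real) \<Rightarrow> bool" where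
  "summable_variations A \<phi> \<longleftrightarrow> (\<Sum>m. variation A \<phi> (m + 2)) < \<infinity>"

text \<open>
  If the matrix is locally compact, every point has finitely many preimages (see
  \<open>finite_preimages\<close> below) and the sum over the preimages is a finite sum; without local
  compactness, \<open>infsum\<close> would return 0 for a divergent series.
\<close>

definition ruelle ::
  "('s \<Rightarrow> 's \<Rightarrow> nat) \<Rightarrow> ((nat \<Rightarrow> 's) \<Rightarrow> real) \<Rightarrow> ((nat \<Rightarrow> 's) \<Rightarrow> real) \<Rightarrow> (nat \<Rightarrow> 's) \<Rightarrow> real" where
  "ruelle A \<phi> f x = (\<Sum>\<^sub>\<infinity>y \<in> {y \<in> one_sided_shift A. left_shift y = x}. exp (\<phi> y) * f y)"

lemma locally_compact_matrix_finite:
  assumes "locally_compact_matrix A"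
  shows "finite {b. A a b \<noteq> 0}" "finite {b. A b a \<noteq> 0}"
proof -
  have fin: "finite {b. g b \<noteq> 0}"
    if lt: "(\<Sum>\<^sub>\<infinity>b. (of_nat (g b) :: ennreal)) < \<infinity>" for g :: "'a \<Rightarrow> nat"
  proof (rule ccontr)
    assume inf: "infinite {b. g b \<noteq> 0}"
    have le: "of_nat n \<le> (\<Sum>\<^sub>\<infinity>b. (of_nat (g b) :: ennreal))" for n
    proof -
      obtain F where F: "F \<subseteq> {b. g b \<noteq> 0}" "finite F" "card F = n"
        using infinite_arbitrarily_large[OF inf] by blast
      have "(of_nat n :: ennreal) = of_nat (\<Sum>b\<in>F. 1)" using F by simp
      also have "\<dots> \<le> of_nat (\<Sum>b\<in>F. g b)"
        unfolding of_nat_le_iff by (rule sum_mono) (use F in \<open>auto simp: Suc_le_eq\<close>)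
      also have "\<dots> = (\<Sum>\<^sub>\<infinity>b\<in>F. of_nat (g b))" using F by simp
      also have "\<dots> \<le> (\<Sum>\<^sub>\<infinity>b. of_nat (g b))"
        by (rule infsum_mono_neutral) (auto intro: nonneg_summable_on_complete)
      finally show ?thesis .
    qed
    obtain n where "(\<Sum>\<^sub>\<infinity>b. (of_nat (g b) :: ennreal)) < of_nat n"
      using ennreal_Ex_less_of_nat lt by (metis infinity_ennreal_def)
    with le[of n] show False by simp
  qed
  show "finite {b. A a b \<noteq> 0}" "finite {b. A b a \<noteq> 0}"
    using assms fin[of "\<lambda>b. A a b"] fin[of "\<lambda>b. A b a"]
    unfolding locally_compact_matrix_def by auto
qed

lemma finite_preimages:
  assumes "locally_compact_matrix A"
  shows "finite {y \<in> one_sided_shift A. left_shift y = x}"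
proof (rule finite_subset)
  show "{y \<in> one_sided_shift A. left_shift y = x} \<subseteq>
        (\<lambda>b. case_nat b x) ` {b. A b (x 0) \<noteq> 0}"
  proof
    fix y assume "y \<in> {y \<in> one_sided_shift A. left_shift y = x}"
    then have "y = case_nat (y 0) x" "A (y 0) (x 0) \<noteq> 0"
      by (auto simp: one_sided_shift_def left_shift_def fun_eq_iff split: nat.split)
    then show "y \<in> (\<lambda>b. case_nat b x) ` {b. A b (x 0) \<noteq> 0}" by blast
  qed
qed (use locally_compact_matrix_finite(2)[OF assms] in simp)

definition compactly_supported :: "('s \<Rightarrow> 's \<Rightarrow> nat) \<Rightarrow> ((nat \<Rightarrow> 's) \<Rightarrow> real) \<Rightarrow> bool" where
  "compactly_supported A f \<longleftrightarrow>
     compactin (shift_topology A) (shift_topology A closure_of {x \<in> one_sided_shift A. f x \<noteq> 0})"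

definition transient ::
  "('s \<Rightarrow> 's \<Rightarrow> nat) \<Rightarrow> real \<Rightarrow> ((nat \<Rightarrow> 's) \<Rightarrow> real) \<Rightarrow> bool" where
  "transient A r \<phi> \<longleftrightarrow>
     (\<forall>f. continuous_map (shift_topology A) euclideanreal f \<longrightarrow> compactly_supported A f \<longrightarrow>
          (\<forall>x\<in>one_sided_shift A. 0 \<le> f x) \<longrightarrow> (\<exists>x\<in>one_sided_shift A. f x \<noteq> 0) \<longrightarrow>
          (\<forall>x\<in>one_sided_shift A. summable (\<lambda>n. (ruelle A \<phi> ^^ n) f x / r ^ n)))"

end

theory Submission
  imports Defs
begin

text \<open>
  Normalise the Green functions \<open>\<Sum>n. r\<^sup>-\<^sup>n L\<^sup>n 1\<^bsub>[a]\<^esub>\<close> at a base point. They are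
  \<open>r\<close>-superharmonic, and \<open>r\<close>-harmonic at every point outside the cylinder \<open>[a]\<close>. Transitivity gives
  Harnack bounds and the summable variations give an oscillation bound, both independent of \<open>a\<close>.
  By Tychonoff's theorem the functions obeying these bounds form a compact set, and
  harmonicity at a single point is a closed condition since \<open>L\<close> is a finite sum. Finitely many points
  lie outside \<open>[a]\<close> for some \<open>a\<close>, so the finite intersection property yields a
  function that is harmonic everywhere.
\<close>

section \<open>Preimages and the Ruelle operator\<close>

lemma case_nat_in_shift_iff:
  assumes "x \<in> one_sided_shift A"
  shows "case_nat b x \<in> one_sided_shift A \<longleftrightarrow> A b (x 0) = 1"
  using assms by (auto simp: one_sided_shift_def split: nat.split)

lemma left_shift_in_shift: "x \<in> one_sided_shift A \<Longrightarrow> left_shift x \<in> one_sided_shift A"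
  by (auto simp: one_sided_shift_def left_shift_def)

lemma finite_predecessors:
  assumes "locally_compact_matrix A"
  shows "finite {b. A b c = 1}"
  by (rule finite_subset[OF _ locally_compact_matrix_finite(2)[OF assms, of c]]) auto

text \<open>The preimages of \<open>x\<close> are the sequences obtained by prepending an admissible
  state, and local compactness leaves finitely many. In this form the operator at \<open>x\<close>
  reads finitely many values of \<open>f\<close>, so it commutes with convergent series and depends
  continuously on \<open>f\<close> pointwise.\<close>

lemma ruelle_eq_sum:
  assumes "x \<in> one_sided_shift A" and "locally_compact_matrix A"
  shows "ruelle A \<phi> f x =
    (\<Sum>b\<in>{b. A b (x 0) = 1}. exp (\<phi> (case_nat b x)) * f (case_nat b x))"
proof -
  have eq: "{y \<in> one_sided_shift A. left_shift y = x} = (\<lambda>b. case_nat b x) ` {b. A b (x 0) = 1}"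
  proof (intro equalityI subsetI)
    fix y assume y: "y \<in> {y \<in> one_sided_shift A. left_shift y = x}"
    then have "y = case_nat (y 0) x" "A (y 0) (x 0) = 1"
      by (auto simp: one_sided_shift_def left_shift_def fun_eq_iff split: nat.split)
    then show "y \<in> (\<lambda>b. case_nat b x) ` {b. A b (x 0) = 1}" by blast
  qed (use assms in \<open>auto simp: case_nat_in_shift_iff left_shift_def\<close>)
  have inj: "inj_on (\<lambda>b. case_nat b x) {b. A b (x 0) = 1}"
    by (rule inj_onI) (metis nat.case(1))
  have "ruelle A \<phi> f x =
      (\<Sum>y\<in>{y \<in> one_sided_shift A. left_shift y = x}. exp (\<phi> y) * f y)"
    unfolding ruelle_def using finite_preimages[OF assms(2)] by (rule infsum_finite)
  also have "\<dots> = (\<Sum>b\<in>{b. A b (x 0) = 1}. exp (\<phi> (case_nat b x)) * f (case_nat b x))"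
    unfolding eq by (subst sum.reindex[OF inj]) simp
  finally show ?thesis .
qed

lemma ruelle_iterate_nonneg:
  assumes "locally_compact_matrix A" and "\<And>x. x \<in> one_sided_shift A \<Longrightarrow> 0 \<le> f x"
    and "x \<in> one_sided_shift A"
  shows "0 \<le> (ruelle A \<phi> ^^ n) f x"
  using assms(3)
proof (induction n arbitrary: x)
  case (Suc n)
  then show ?case
    by (auto simp: ruelle_eq_sum[OF _ assms(1)] case_nat_in_shift_iff intro!: sum_nonneg)
qed (use assms in auto)

text \<open>A single term of a sum of nonnegative terms is at most the sum. This is the one-step
  estimate behind the Harnack bounds.\<close>

lemma ruelle_preimage_le:
  assumes "locally_compact_matrix A" and "\<And>x. x \<in> one_sided_shift A \<Longrightarrow> 0 \<le> f x"
    and "y \<in> one_sided_shift A"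
  shows "exp (\<phi> y) * f y \<le> ruelle A \<phi> f (left_shift y)"
proof -
  let ?x = "left_shift y"
  have x: "?x \<in> one_sided_shift A" using assms(3) by (rule left_shift_in_shift)
  have y: "case_nat (y 0) ?x = y"
    by (auto simp: left_shift_def fun_eq_iff split: nat.split)
  have "A (y 0) (?x 0) = 1"
    using assms(3) by (simp add: one_sided_shift_def left_shift_def)
  then have "exp (\<phi> (case_nat (y 0) ?x)) * f (case_nat (y 0) ?x) \<le> ruelle A \<phi> f ?x"
    unfolding ruelle_eq_sum[OF x assms(1)]
    by (intro member_le_sum)
       (use assms(2) x finite_predecessors[OF assms(1)] in \<open>auto simp: case_nat_in_shift_iff\<close>)
  then show ?thesis by (simp only: y)
qed

section \<open>Topology of the shift and indicators of cylinders\<close>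

text \<open>The ball of radius \<open>(1 / 2) ^ m\<close> around \<open>x\<close> consists of the
  points that agree with \<open>x\<close> on the coordinates 0 to \<open>m\<close>, so the criterion
  is the metric one.\<close>

lemma continuous_map_shiftI:
  assumes "\<And>x e. x \<in> one_sided_shift A \<Longrightarrow> 0 < e \<Longrightarrow>
    \<exists>m. \<forall>y\<in>one_sided_shift A. (\<forall>i\<le>m. x i = y i) \<longrightarrow> \<bar>f y - f x\<bar> < e"
  shows "continuous_map (shift_topology A) euclideanreal f"
proof -
  interpret Metric_space "one_sided_shift A" shift_dist by (rule Metric_space_shift_dist)
  have "openin mtopology {x \<in> one_sided_shift A. f x \<in> U}" if U: "open U" for U
    unfolding openin_mtopology
  proof (intro conjI allI impI)
    fix x assume x: "x \<in> {x \<in> one_sided_shift A. f x \<in> U}"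
    then obtain e where e: "0 < e" "ball (f x) e \<subseteq> U"
      using openE[OF U, of "f x"] by auto
    obtain m where m: "\<forall>y\<in>one_sided_shift A. (\<forall>i\<le>m. x i = y i) \<longrightarrow> \<bar>f y - f x\<bar> < e"
      using assms[of x e] x e(1) by auto
    have "mball x ((1 / 2) ^ m) \<subseteq> {x \<in> one_sided_shift A. f x \<in> U}"
    proof
      fix y assume y: "y \<in> mball x ((1 / 2) ^ m)"
      then have "\<bar>f y - f x\<bar> < e" using m by (auto simp: shift_dist_less_iff)
      then have "f y \<in> ball (f x) e" by (simp add: dist_real_def)
      then show "y \<in> {x \<in> one_sided_shift A. f x \<in> U}" using e y by auto
    qed
    then show "\<exists>d>0. mball x d \<subseteq> {x \<in> one_sided_shift A. f x \<in> U}"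
      by (intro exI[of _ "(1 / 2) ^ m"]) simp
  qed auto
  then show ?thesis
    by (auto simp: continuous_map_def shift_topology_def)
qed

text \<open>Each state has finitely many successors, so coordinate \<open>i\<close> takes finitely
  many values on the cylinder. The cylinder is therefore a closed subset of a product of finite
  sets, compact by Tychonoff, and compactness is then carried to the metric topology.\<close>

lemma compactin_cylinder:
  assumes "locally_compact_matrix A"
  shows "compactin (shift_topology A) {x \<in> one_sided_shift A. x 0 = a}"
proof -
  interpret Metric_space "one_sided_shift A" shift_dist by (rule Metric_space_shift_dist)
  define P where "P = product_topology (\<lambda>_::nat. discrete_topology (UNIV :: 'a set)) UNIV"
  \<comment> \<open>\<open>B n\<close> is the set of states reachable from \<open>a\<close> in
    exactly \<open>n\<close> transitions.\<close>
  define B where "B = rec_nat {a} (\<lambda>_ S. \<Union>b\<in>S. {c. A b c \<noteq> 0})"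
  have "finite (B n)" for n
    by (induction n) (simp_all add: B_def locally_compact_matrix_finite(1)[OF assms] del: neq0_conv)
  then have comp: "compactin P (Pi\<^sub>E UNIV B)"
    by (simp add: P_def compactin_PiE finite_imp_compactin_eq)
  let ?C = "{x \<in> one_sided_shift A. x 0 = a}"
  have proj: "continuous_map P (discrete_topology UNIV) (\<lambda>x. x i)" for i
    unfolding P_def by (rule continuous_map_product_projection) simp
  have clopen: "openin P {x. Q (x i)}" for Q i
    using openin_continuous_map_preimage[OF proj[of i], of "{b. Q b}"]
    by (simp add: P_def)
  have "closedin P ?C"
  proof -
    \<comment> \<open>The complement of the cylinder: a wrong first state or a forbidden transition
      somewhere. Naming the state \<open>b\<close> at coordinate \<open>i\<close> splits a condition
      on two coordinates into conditions on one coordinate each, to which \<open>clopen\<close>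
      applies.\<close>
    let ?V = "{x. x 0 \<noteq> a} \<union> (\<Union>i. \<Union>b. {x. x i = b} \<inter> {x. A b (x (Suc i)) \<noteq> 1})"
    have "openin P ?V"
      by (intro openin_Un openin_Union openin_Int clopen) (auto intro!: openin_Int clopen openin_Union)
    then have "closedin P (topspace P - ?V)" by (intro closedin_diff closedin_topspace)
    moreover have "topspace P - ?V = ?C"
      by (auto simp: one_sided_shift_def P_def)
    ultimately show ?thesis by (simp only:)
  qed
  moreover have "?C \<subseteq> Pi\<^sub>E UNIV B"
  proof
    fix x assume x: "x \<in> ?C"
    have "x i \<in> B i" for i
    proof (induction i)
      case (Suc i)
      moreover have "A (x i) (x (Suc i)) \<noteq> 0" using x by (simp add: one_sided_shift_def)
      ultimately show ?case by (auto simp: B_def)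
    qed (use x in \<open>simp add: B_def\<close>)
    then show "x \<in> Pi\<^sub>E UNIV B" by auto
  qed
  ultimately have "compactin P ?C"
    using comp closed_compactin by blast
  then have "compactin (subtopology P (one_sided_shift A)) ?C"
    by (auto simp: compactin_subtopology)
  \<comment> \<open>The identity from the product topology to the metric topology pushes compactness
    forward: every small metric ball contains the trace of a finite intersection of coordinate
    conditions.\<close>
  moreover have "continuous_map (subtopology P (one_sided_shift A)) mtopology (\<lambda>x. x)"
    unfolding continuous_map_def
  proof (intro conjI allI impI)
    fix U assume U: "openin mtopology U"
    have "\<exists>V. openin P V \<and> x \<in> V \<and> V \<inter> one_sided_shift A \<subseteq> U" if x: "x \<in> U" for x
    proof -
      obtain e where e: "0 < e" "mball x e \<subseteq> U" using U x unfolding openin_mtopology by blast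
      obtain n where n: "(1 / 2) ^ n < e" using real_arch_pow_inv[of e "1/2"] e by auto
      have "openin P (\<Inter>i\<in>{..n}. {y. x i = y i})"
        by (rule openin_Inter) (auto intro: clopen)
      moreover have "(\<Inter>i\<in>{..n}. {y. x i = y i}) \<inter> one_sided_shift A \<subseteq> U"
      proof
        fix y assume y: "y \<in> (\<Inter>i\<in>{..n}. {y. x i = y i}) \<inter> one_sided_shift A"
        then have "shift_dist x y < (1 / 2) ^ n" by (simp add: shift_dist_less_iff)
        then have "y \<in> mball x e" using y n x U openin_mtopology by auto
        then show "y \<in> U" using e by blast
      qed
      ultimately show ?thesis by (intro exI[of _ "\<Inter>i\<in>{..n}. {y. x i = y i}"]) auto
    qed
    then obtain V where V: "\<And>x. x \<in> U \<Longrightarrow> openin P (V x) \<and> x \<in> V x \<and> V x \<inter> one_sided_shift A \<subseteq> U"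
      by metis
    have "U \<subseteq> one_sided_shift A" using U openin_mtopology by blast
    then have "U = (\<Union>x\<in>U. V x) \<inter> one_sided_shift A" using V by blast
    moreover have "openin P (\<Union>x\<in>U. V x)" using V by blast
    ultimately have "openin (subtopology P (one_sided_shift A)) U"
      unfolding openin_subtopology by blast
    moreover have "{x \<in> topspace (subtopology P (one_sided_shift A)). x \<in> U} = U"
      using \<open>U \<subseteq> one_sided_shift A\<close> by (auto simp: P_def)
    ultimately show "openin (subtopology P (one_sided_shift A))
        {x \<in> topspace (subtopology P (one_sided_shift A)). x \<in> U}" by simp
  qed (auto simp: P_def)
  ultimately show ?thesis
    unfolding shift_topology_def using image_compactin by fastforce
qed

text \<open>The set where the indicator is nonzero is the cylinder itself, which is its own closure
  because compact sets in a metric space are closed.\<close>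

lemma compactly_supported_cylinder:
  assumes "locally_compact_matrix A"
  shows "compactly_supported A (indicat_real {x. x 0 = a})"
proof -
  interpret Metric_space "one_sided_shift A" shift_dist by (rule Metric_space_shift_dist)
  have "closedin (shift_topology A) {x \<in> one_sided_shift A. x 0 = a}"
    using compactin_cylinder[OF assms] unfolding shift_topology_def
    by (rule compactin_imp_closedin[OF Hausdorff_space_mtopology])
  moreover have "{x \<in> one_sided_shift A. indicat_real {x. x 0 = a} x \<noteq> 0} =
      {x \<in> one_sided_shift A. x 0 = a}" by (auto simp: indicator_def)
  ultimately show ?thesis
    unfolding compactly_supported_def
    using compactin_cylinder[OF assms] by (simp add: closure_of_closedin)
qed

text \<open>Paths of length at least 1 give every state a successor; iterating a choice of
  successors from \<open>a\<close> produces a point.\<close>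

lemma transitive_matrix_cylinder_nonempty:
  assumes "transitive_matrix A"
  shows "\<exists>x\<in>one_sided_shift A. x 0 = a"
proof -
  have "\<exists>c. A b c = 1" for b
  proof -
    obtain n and p :: "nat \<Rightarrow> 'a" where "n \<ge> 1" "p 0 = b" "\<forall>i<n. A (p i) (p (Suc i)) = 1"
      using assms unfolding transitive_matrix_def by metis
    then show ?thesis by (intro exI[of _ "p 1"]) (metis One_nat_def Suc_le_eq)
  qed
  then obtain s where s: "\<And>b. A b (s b) = 1" by metis
  show ?thesis
    by (rule bexI[of _ "\<lambda>n. (s ^^ n) a"]) (auto simp: one_sided_shift_def s)
qed

text \<open>Transience applies to the indicator of a cylinder, which depends on coordinate 0 only
  and hence is continuous. This makes the Green series converge.\<close>

lemma transient_summable_cylinder: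
  assumes "transient A r \<phi>" and "locally_compact_matrix A" and "transitive_matrix A"
    and "x \<in> one_sided_shift A"
  shows "summable (\<lambda>n. (ruelle A \<phi> ^^ n) (indicat_real {x. x 0 = a}) x / r ^ n)"
proof -
  have cont: "continuous_map (shift_topology A) euclideanreal (indicat_real {x. x 0 = a})"
    by (rule continuous_map_shiftI) (rule exI[of _ 0], auto simp: indicator_def)
  have "\<exists>x\<in>one_sided_shift A. indicat_real {x. x 0 = a} x \<noteq> 0"
    using transitive_matrix_cylinder_nonempty[OF assms(3), of a] by (auto simp: indicator_def)
  then show ?thesis
    by (intro assms(1)[unfolded transient_def, rule_format, OF cont] assms(4)
        compactly_supported_cylinder[OF assms(2)]) simp_all
qed

section \<open>Summable variations and distortion of the iterates\<close>

text \<open>The sum of all variations of order greater than \<open>m\<close>. It is used for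
  \<open>m\<close> \<ge> 1, where only orders from 2 on occur; these are finite, so
  \<open>enn2real\<close> loses nothing.\<close>

definition variation_tail :: "('s \<Rightarrow> 's \<Rightarrow> nat) \<Rightarrow> ((nat \<Rightarrow> 's) \<Rightarrow> real) \<Rightarrow> nat \<Rightarrow> real" where
  "variation_tail A \<phi> m = (\<Sum>k. enn2real (variation A \<phi> (k + m + 1)))"

context
  fixes A :: "'s \<Rightarrow> 's \<Rightarrow> nat" and \<phi> :: "(nat \<Rightarrow> 's) \<Rightarrow> real"
  assumes sv: "summable_variations A \<phi>"
begin

lemma variation_finite:
  assumes "m \<ge> 2"
  shows "variation A \<phi> m \<noteq> top"
proof
  assume "variation A \<phi> m = top"
  then have "variation A \<phi> ((m - 2) + 2) = top"
    using assms by (simp only: le_add_diff_inverse2)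
  moreover have "variation A \<phi> ((m - 2) + 2) \<le> (\<Sum>m. variation A \<phi> (m + 2))"
    using sum_le_suminf[of "\<lambda>m. variation A \<phi> (m + 2)" "{m - 2}"] by auto
  ultimately show False using sv unfolding summable_variations_def
    by (simp add: top_unique)
qed

lemma summable_variation_tail:
  assumes "m \<ge> 1"
  shows "summable (\<lambda>k. enn2real (variation A \<phi> (k + m + 1)))"
proof -
  have "summable (\<lambda>k. enn2real (variation A \<phi> (k + 2)))"
  proof (rule summable_suminf_not_top)
    show "(\<Sum>k. ennreal (enn2real (variation A \<phi> (k + 2)))) \<noteq> top"
      using sv variation_finite unfolding summable_variations_def
      by (simp add: top.not_eq_extremum)
  qed simp
  then have "summable (\<lambda>k. enn2real (variation A \<phi> ((k + (m - 1)) + 2)))"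
    using summable_iff_shift[of "\<lambda>k. enn2real (variation A \<phi> (k + 2))" "m - 1"] by simp
  moreover have "(k + (m - 1)) + 2 = k + m + 1" for k using assms by simp
  ultimately show ?thesis by simp
qed

lemma variation_tail_Suc:
  assumes "m \<ge> 1"
  shows "variation_tail A \<phi> m = enn2real (variation A \<phi> (Suc m)) + variation_tail A \<phi> (Suc m)"
  using suminf_split_head[OF summable_variation_tail[OF assms]]
  by (simp add: variation_tail_def)

lemma variation_tail_nonneg: "m \<ge> 1 \<Longrightarrow> 0 \<le> variation_tail A \<phi> m"
  unfolding variation_tail_def by (intro suminf_nonneg summable_variation_tail) auto

lemma variation_tail_tendsto_0: "(\<lambda>m. variation_tail A \<phi> (Suc m)) \<longlonglongrightarrow> 0"
proof -
  have "(\<lambda>m. \<Sum>k. enn2real (variation A \<phi> ((k + m) + 1 + 1))) \<longlonglongrightarrow> 0"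
    by (rule suminf_exist_split2) (rule summable_variation_tail, simp)
  then show ?thesis by (simp add: variation_tail_def)
qed

lemma potential_le_variation:
  assumes "x \<in> one_sided_shift A" "y \<in> one_sided_shift A" "\<And>i. i < m \<Longrightarrow> x i = y i" "m \<ge> 2"
  shows "\<phi> x \<le> \<phi> y + enn2real (variation A \<phi> m)"
proof -
  have "ennreal \<bar>\<phi> x - \<phi> y\<bar> \<le> variation A \<phi> m"
    unfolding variation_def by (rule Sup_upper) (use assms in blast)
  also have "\<dots> = ennreal (enn2real (variation A \<phi> m))"
    using variation_finite[OF assms(4)] by (simp add: top.not_eq_extremum)
  finally show ?thesis by (simp add: ennreal_le_iff)
qed

text \<open>Prepending the same state to two points that agree on \<open>m\<close> coordinates makes
  them agree on \<open>m + 1\<close>, at the cost of a factor exp of the variation of order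
  \<open>m + 1\<close>. Along \<open>n\<close> steps the costs add up to at most the tail, whence a
  bound independent of \<open>n\<close> and \<open>a\<close>.\<close>

lemma ruelle_iterate_oscillation:
  assumes "locally_compact_matrix A" and "m \<ge> 1"
    and "x \<in> one_sided_shift A" "y \<in> one_sided_shift A" "\<And>i. i < m \<Longrightarrow> x i = y i"
  shows "(ruelle A \<phi> ^^ n) (indicat_real {x. x 0 = a}) x \<le>
    exp (variation_tail A \<phi> m) * (ruelle A \<phi> ^^ n) (indicat_real {x. x 0 = a}) y"
  using assms(2-)
proof (induction n arbitrary: m x y)
  case 0
  then have "x 0 = y 0" by simp
  then show ?case using variation_tail_nonneg[OF 0(1)] by (auto simp: indicator_def)
next
  case (Suc n)
  let ?P = "(ruelle A \<phi> ^^ n) (indicat_real {x. x 0 = a})"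
  let ?v = "enn2real (variation A \<phi> (Suc m))"
  have "exp (\<phi> (case_nat b x)) * ?P (case_nat b x) \<le>
      exp (variation_tail A \<phi> m) * (exp (\<phi> (case_nat b y)) * ?P (case_nat b y))"
    if b: "A b (x 0) = 1" for b
  proof -
    have xy: "x 0 = y 0" using Suc.prems by simp
    have X: "case_nat b x \<in> one_sided_shift A" "case_nat b y \<in> one_sided_shift A"
      using Suc.prems b xy by (simp_all add: case_nat_in_shift_iff)
    have agree: "case_nat b x i = case_nat b y i" if "i < Suc m" for i
      using that Suc.prems by (auto split: nat.split)
    have "?P (case_nat b x) \<le> exp (variation_tail A \<phi> (Suc m)) * ?P (case_nat b y)"
      by (rule Suc.IH) (use X agree in auto)
    moreover have "exp (\<phi> (case_nat b x)) \<le> exp (\<phi> (case_nat b y) + ?v)"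
      using potential_le_variation[OF X agree] Suc.prems by simp
    moreover have "0 \<le> ?P (case_nat b x)"
      by (rule ruelle_iterate_nonneg) (use assms X in auto)
    ultimately have "exp (\<phi> (case_nat b x)) * ?P (case_nat b x) \<le>
        exp (\<phi> (case_nat b y) + ?v) * (exp (variation_tail A \<phi> (Suc m)) * ?P (case_nat b y))"
      by (intro mult_mono) auto
    also have "\<dots> = exp (variation_tail A \<phi> m) * (exp (\<phi> (case_nat b y)) * ?P (case_nat b y))"
      by (simp add: variation_tail_Suc[OF Suc.prems(1)] exp_add)
    finally show ?thesis .
  qed
  \<comment> \<open>Since \<open>m\<close> \<ge> 1, both points have the same admissible
    predecessors, so the two sums can be compared term by term.\<close>
  moreover have "x 0 = y 0" using Suc.prems by simp
  ultimately show ?case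
    using Suc.prems
    by (simp add: ruelle_eq_sum[OF _ assms(1)] sum_distrib_left) (rule sum_mono, simp)
qed

end

section \<open>Superharmonic functions, continuity and Harnack bounds\<close>

text \<open>Each inequality is homogeneous and involves two values of \<open>g\<close>, so the
  property survives positive scaling and pointwise limits.\<close>

definition oscillation_bounded ::
  "('s \<Rightarrow> 's \<Rightarrow> nat) \<Rightarrow> ((nat \<Rightarrow> 's) \<Rightarrow> real) \<Rightarrow> ((nat \<Rightarrow> 's) \<Rightarrow> real) \<Rightarrow> bool" where
  "oscillation_bounded A \<phi> g \<longleftrightarrow>
     (\<forall>m\<ge>1. \<forall>x\<in>one_sided_shift A. \<forall>y\<in>one_sided_shift A. (\<forall>i<m. x i = y i) \<longrightarrow>
        g x \<le> exp (variation_tail A \<phi> m) * g y)"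

definition superharmonic ::
  "('s \<Rightarrow> 's \<Rightarrow> nat) \<Rightarrow> real \<Rightarrow> ((nat \<Rightarrow> 's) \<Rightarrow> real) \<Rightarrow> ((nat \<Rightarrow> 's) \<Rightarrow> real) \<Rightarrow> bool" where
  "superharmonic A r \<phi> g \<longleftrightarrow>
     (\<forall>x\<in>one_sided_shift A. 0 \<le> g x \<and> ruelle A \<phi> g x \<le> r * g x)"

text \<open>Using the bound in both directions pinches \<open>g y\<close> between
  \<open>exp (- t) * g x\<close> and \<open>exp t * g x\<close>, where the tail \<open>t\<close>
  tends to 0 as the agreement grows.\<close>

lemma continuous_map_oscillation_bounded:
  assumes "summable_variations A \<phi>" and "oscillation_bounded A \<phi> g"
  shows "continuous_map (shift_topology A) euclideanreal g"
proof (rule continuous_map_shiftI)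
  fix x and e :: real assume x: "x \<in> one_sided_shift A" and e: "0 < e"
  let ?t = "\<lambda>m. variation_tail A \<phi> (Suc m)"
  note t = variation_tail_tendsto_0[OF assms(1)]
  have "(\<lambda>m. exp (?t m) * g x) \<longlonglongrightarrow> exp 0 * g x" "(\<lambda>m. exp (- ?t m) * g x) \<longlonglongrightarrow> exp (- 0) * g x"
    by (intro tendsto_intros t)+
  then have "\<forall>\<^sub>F m in sequentially. dist (exp (?t m) * g x) (g x) < e"
    "\<forall>\<^sub>F m in sequentially. dist (exp (- ?t m) * g x) (g x) < e"
    using e by (simp_all add: tendstoD)
  then have "\<forall>\<^sub>F m in sequentially. dist (exp (?t m) * g x) (g x) < e \<and>
      dist (exp (- ?t m) * g x) (g x) < e"
    by (rule eventually_conj)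
  then obtain m where m: "dist (exp (?t m) * g x) (g x) < e" "dist (exp (- ?t m) * g x) (g x) < e"
    unfolding eventually_sequentially by blast
  have "\<bar>g y - g x\<bar> < e" if y: "y \<in> one_sided_shift A" "\<forall>i\<le>m. x i = y i" for y
  proof -
    have "g y \<le> exp (?t m) * g x" "g x \<le> exp (?t m) * g y"
      using assms(2) x y unfolding oscillation_bounded_def by (auto simp: less_Suc_eq_le)
    moreover from this(2) have "exp (- ?t m) * g x \<le> g y"
      by (simp add: exp_minus field_simps)
    ultimately show ?thesis using m by (simp add: dist_real_def abs_less_iff)
  qed
  then show "\<exists>m. \<forall>y\<in>one_sided_shift A. (\<forall>i\<le>m. x i = y i) \<longrightarrow> \<bar>g y - g x\<bar> < e" by blast
qed

text \<open>Keeping one preimage \<open>w\<close> of \<open>v\<close> in the superharmonic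
  inequality bounds \<open>g w\<close> by \<open>r / exp (\<phi> w)\<close> times
  \<open>g v\<close>. Following the path backwards multiplies these factors; \<open>C\<close> and
  \<open>y\<close> depend on the path and \<open>v\<close>, not on \<open>g\<close>.\<close>

lemma superharmonic_path:
  assumes "locally_compact_matrix A" and "0 < r"
    and "v \<in> one_sided_shift A" "p n = v 0" "\<forall>i<n. A (p i) (p (Suc i)) = 1"
  shows "\<exists>C>0. \<exists>y\<in>one_sided_shift A. y 0 = p 0 \<and>
    (\<forall>g. superharmonic A r \<phi> g \<longrightarrow> g y \<le> C * g v)"
  using assms(3-)
proof (induction n arbitrary: v)
  case 0
  then show ?case by (intro exI[of _ 1]) auto
next
  case (Suc n)
  \<comment> \<open>The transition from \<open>p n\<close> to \<open>p (Suc n) = v 0\<close> is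
    admissible, so the last edge of the path is removed by prepending its source to
    \<open>v\<close>.\<close>
  define w where "w = case_nat (p n) v"
  have w: "w \<in> one_sided_shift A" "w 0 = p n" "left_shift w = v"
    using Suc.prems by (auto simp: w_def case_nat_in_shift_iff left_shift_def)
  obtain C y where C: "C > 0" "y \<in> one_sided_shift A" "y 0 = p 0"
      "\<And>g. superharmonic A r \<phi> g \<Longrightarrow> g y \<le> C * g w"
    using Suc.IH[OF w(1)] w Suc.prems by auto
  have "g y \<le> (C * (r / exp (\<phi> w))) * g v" if g: "superharmonic A r \<phi> g" for g
  proof -
    have "exp (\<phi> w) * g w \<le> ruelle A \<phi> g v"
      using ruelle_preimage_le[OF assms(1) _ w(1), of g \<phi>] w(3) g
      by (simp add: superharmonic_def)
    also have "\<dots> \<le> r * g v" using g Suc.prems by (simp add: superharmonic_def)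
    finally have "g w \<le> (r / exp (\<phi> w)) * g v" by (simp add: field_simps)
    then have "C * g w \<le> C * ((r / exp (\<phi> w)) * g v)"
      using C(1) by (intro mult_left_mono) auto
    then show ?thesis using C(4)[OF g] by (simp add: mult.assoc)
  qed
  then show ?case
    using C assms(2) by (intro exI[of _ "C * (r / exp (\<phi> w))"]) auto
qed

text \<open>A path from \<open>u 0\<close> to \<open>v 0\<close> controls \<open>g\<close> at some
  point \<open>y\<close> with the same first state as \<open>u\<close>; the oscillation bound for
  \<open>m = 1\<close> passes from \<open>y\<close> to \<open>u\<close>.\<close>

lemma harnack:
  assumes "locally_compact_matrix A" and "0 < r" and "transitive_matrix A"
    and "u \<in> one_sided_shift A" "v \<in> one_sided_shift A"
  shows "\<exists>C>0. \<forall>g. superharmonic A r \<phi> g \<and> oscillation_bounded A \<phi> g \<longrightarrow> g u \<le> C * g v"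
proof -
  obtain n p where p: "p 0 = u 0" "p n = v 0" "\<forall>i<n. A (p i) (p (Suc i)) = 1"
    using assms(3) unfolding transitive_matrix_def by metis
  obtain C y where C: "C > 0" "y \<in> one_sided_shift A" "y 0 = p 0"
      "\<And>g. superharmonic A r \<phi> g \<Longrightarrow> g y \<le> C * g v"
    using superharmonic_path[OF assms(1,2,5) p(2,3)] by blast
  have "g u \<le> (exp (variation_tail A \<phi> 1) * C) * g v"
    if g: "superharmonic A r \<phi> g" "oscillation_bounded A \<phi> g" for g
  proof -
    have "\<forall>i<1. u i = y i" using C(3) p(1) by simp
    then have "g u \<le> exp (variation_tail A \<phi> 1) * g y"
      using g(2) C(2) assms(4) unfolding oscillation_bounded_def by blast
    also have "\<dots> \<le> exp (variation_tail A \<phi> 1) * (C * g v)" using C(4)[OF g(1)] by simp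
    finally show ?thesis by (simp add: mult.assoc)
  qed
  then show ?thesis using C(1) by (intro exI[of _ "exp (variation_tail A \<phi> 1) * C"]) auto
qed

section \<open>Normalised Green functions\<close>

text \<open>Applying the operator shifts the series by one index and produces a factor
  \<open>r\<close>; the term lost is the one for \<open>n = 0\<close>, namely
  \<open>f x\<close>.\<close>

lemma ruelle_green:
  assumes lc: "locally_compact_matrix A" and "r > 0"
    and summ: "\<And>x. x \<in> one_sided_shift A \<Longrightarrow> summable (\<lambda>n. (ruelle A \<phi> ^^ n) f x / r ^ n)"
    and x: "x \<in> one_sided_shift A"
  shows "ruelle A \<phi> (\<lambda>x. \<Sum>n. (ruelle A \<phi> ^^ n) f x / r ^ n) x =
    r * ((\<Sum>n. (ruelle A \<phi> ^^ n) f x / r ^ n) - f x)"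
proof -
  let ?P = "\<lambda>n. (ruelle A \<phi> ^^ n) f"
  let ?B = "{b. A b (x 0) = 1}"
  have sb: "summable (\<lambda>n. ?P n (case_nat b x) / r ^ n)" if "b \<in> ?B" for b
    by (rule summ) (use that x in \<open>simp add: case_nat_in_shift_iff\<close>)
  have "ruelle A \<phi> (\<lambda>x. \<Sum>n. ?P n x / r ^ n) x =
      (\<Sum>b\<in>?B. \<Sum>n. exp (\<phi> (case_nat b x)) * (?P n (case_nat b x) / r ^ n))"
    unfolding ruelle_eq_sum[OF x lc] by (intro sum.cong refl suminf_mult[symmetric] sb)
  also have "\<dots> = (\<Sum>n. \<Sum>b\<in>?B. exp (\<phi> (case_nat b x)) * (?P n (case_nat b x) / r ^ n))"
    by (intro suminf_sum[symmetric] summable_mult sb)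
  also have "\<dots> = (\<Sum>n. r * (?P (Suc n) x / r ^ Suc n))"
    using assms(2)
    by (intro suminf_cong) (simp add: ruelle_eq_sum[OF x lc] sum_divide_distrib sum_distrib_left)
  also have "\<dots> = r * (\<Sum>n. ?P (Suc n) x / r ^ Suc n)"
  proof (rule suminf_mult)
    show "summable (\<lambda>n. ?P (Suc n) x / r ^ Suc n)"
      using summable_Suc_iff[of "\<lambda>n. ?P n x / r ^ n"] summ[OF x] by blast
  qed
  also have "(\<Sum>n. ?P (Suc n) x / r ^ Suc n) = (\<Sum>n. ?P n x / r ^ n) - f x"
    using suminf_split_head[OF summ[OF x]] by simp
  finally show ?thesis .
qed

text \<open>The Green function \<open>G\<close> of the cylinder of \<open>a\<close> satisfies L G =
  r (G - f), with \<open>f\<close> its indicator, so harmonicity fails only inside the cylinder.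
  Dividing by \<open>G z\<close> puts the functions for all \<open>a\<close> under the same Harnack
  bounds.\<close>

lemma exists_normalized_superharmonic:
  assumes "transitive_matrix A" and lc: "locally_compact_matrix A" and "r > 0"
    and sv: "summable_variations A \<phi>" and tr: "transient A r \<phi>"
    and z: "z \<in> one_sided_shift A"
  obtains g where "superharmonic A r \<phi> g" "oscillation_bounded A \<phi> g" "g z = 1"
    "\<And>x. x \<in> one_sided_shift A \<Longrightarrow> x 0 \<noteq> a \<Longrightarrow> ruelle A \<phi> g x = r * g x"
proof -
  let ?f = "indicat_real {x. x 0 = a}"
  let ?P = "\<lambda>n. (ruelle A \<phi> ^^ n) ?f"
  define G where "G = (\<lambda>x. \<Sum>n. ?P n x / r ^ n)"
  have P0: "0 \<le> ?P n x" if "x \<in> one_sided_shift A" for n x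
    by (rule ruelle_iterate_nonneg[OF lc _ that]) simp
  have sm: "summable (\<lambda>n. ?P n x / r ^ n)" if "x \<in> one_sided_shift A" for x
    by (rule transient_summable_cylinder[OF tr lc assms(1) that])
  have G0: "0 \<le> G x" if "x \<in> one_sided_shift A" for x
    unfolding G_def by (intro suminf_nonneg sm that divide_nonneg_nonneg P0) (use \<open>r > 0\<close> in auto)
  have LG: "ruelle A \<phi> G x = r * (G x - ?f x)" if "x \<in> one_sided_shift A" for x
    unfolding G_def by (rule ruelle_green[OF lc \<open>r > 0\<close> sm that])
  have sG: "superharmonic A r \<phi> G"
    unfolding superharmonic_def using G0 \<open>r > 0\<close> by (simp add: LG)
  have oG: "oscillation_bounded A \<phi> G"
    unfolding oscillation_bounded_def
  proof (intro allI ballI impI)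
    fix m x y assume m: "1 \<le> m" and xy: "x \<in> one_sided_shift A" "y \<in> one_sided_shift A"
      "\<forall>i<m. x i = y i"
    have "?P n x / r ^ n \<le> exp (variation_tail A \<phi> m) * (?P n y / r ^ n)" for n
      using ruelle_iterate_oscillation[OF sv lc m xy(1,2), of n a] xy(3) \<open>r > 0\<close>
      by (simp add: divide_right_mono)
    then have "G x \<le> (\<Sum>n. exp (variation_tail A \<phi> m) * (?P n y / r ^ n))"
      unfolding G_def by (intro suminf_le sm summable_mult xy)
    then show "G x \<le> exp (variation_tail A \<phi> m) * G y"
      unfolding G_def by (simp only: suminf_mult[OF sm[OF xy(2)]])
  qed
  obtain u where u: "u \<in> one_sided_shift A" "u 0 = a"
    using transitive_matrix_cylinder_nonempty[OF assms(1)] by blast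
  obtain C where C: "C > 0" "G u \<le> C * G z"
    using harnack[OF lc \<open>r > 0\<close> assms(1) u(1) z] sG oG by blast
  \<comment> \<open>At a point of the cylinder the Green identity reads L G = r (G - 1); as the left
    side is nonnegative, \<open>G u\<close> is at least 1, and Harnack transfers positivity to
    \<open>z\<close>.\<close>
  have "0 \<le> ruelle A \<phi> G u"
    unfolding ruelle_eq_sum[OF u(1) lc]
    by (intro sum_nonneg mult_nonneg_nonneg G0) (use u in \<open>auto simp: case_nat_in_shift_iff\<close>)
  then have "1 \<le> G u" using LG[OF u(1)] u(2) \<open>r > 0\<close> by (simp add: zero_le_mult_iff)
  then have Gz: "0 < G z" using C by (metis less_le_trans zero_less_mult_pos zero_less_one)
  define g where "g = (\<lambda>x. G x / G z)"
  have Lg: "ruelle A \<phi> g x = ruelle A \<phi> G x / G z" if "x \<in> one_sided_shift A" for x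
    unfolding ruelle_eq_sum[OF that lc] by (simp add: g_def sum_divide_distrib)
  show thesis
  proof
    show "superharmonic A r \<phi> g"
      using sG Gz unfolding superharmonic_def
      by (simp add: Lg) (simp add: g_def divide_right_mono)
    show "oscillation_bounded A \<phi> g"
      using oG Gz unfolding oscillation_bounded_def g_def by (simp add: divide_right_mono)
    show "g z = 1" using Gz by (simp add: g_def)
    show "ruelle A \<phi> g x = r * g x" if "x \<in> one_sided_shift A" "x 0 \<noteq> a" for x
      using that by (simp add: Lg LG) (simp add: g_def)
  qed
qed

section \<open>Compactness and the positive eigenfunction\<close>

theorem theorem5p10:
  fixes A :: "'s \<Rightarrow> 's \<Rightarrow> nat" and r :: real and \<phi> :: "(nat \<Rightarrow> 's) \<Rightarrow> real"
  assumes "countable (UNIV :: 's set)" and "infinite (UNIV :: 's set)"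
    and "transition_matrix A"
    and "transitive_matrix A"
    and "locally_compact_matrix A"
    and "r > 0"
    and "summable_variations A \<phi>"
    and "transient A r \<phi>"
  shows "\<exists>h. continuous_map (shift_topology A) euclideanreal h \<and>
             (\<forall>x\<in>one_sided_shift A. 0 < h x) \<and>
             (\<forall>x\<in>one_sided_shift A. ruelle A \<phi> h x = r * h x)"
proof -
  note lc = assms(5)
  let ?X = "one_sided_shift A"
  obtain z where z: "z \<in> ?X"
    using transitive_matrix_cylinder_nonempty[OF assms(4), of undefined] by blast
  have "\<forall>x\<in>?X. \<exists>C>0. \<forall>g. superharmonic A r \<phi> g \<and> oscillation_bounded A \<phi> g \<longrightarrow> g x \<le> C * g z"
    by (intro ballI harnack[OF lc assms(6,4) _ z])
  from bchoice[OF this] obtain C where C: "\<And>x. x \<in> ?X \<Longrightarrow> C x > 0"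
      "\<And>x g. x \<in> ?X \<Longrightarrow> superharmonic A r \<phi> g \<Longrightarrow> oscillation_bounded A \<phi> g \<Longrightarrow> g x \<le> C x * g z"
    by blast
  have "\<forall>x\<in>?X. \<exists>C>0. \<forall>g. superharmonic A r \<phi> g \<and> oscillation_bounded A \<phi> g \<longrightarrow> g z \<le> C * g x"
    by (intro ballI harnack[OF lc assms(6,4) z])
  from bchoice[OF this] obtain D where D: "\<And>x. x \<in> ?X \<Longrightarrow> D x > 0"
      "\<And>x g. x \<in> ?X \<Longrightarrow> superharmonic A r \<phi> g \<Longrightarrow> oscillation_bounded A \<phi> g \<Longrightarrow> g z \<le> D x * g x"
    by blast
  \<comment> \<open>For functions with value 1 at \<open>z\<close>, \<open>C\<close> gives the upper
    and \<open>D\<close> the positive lower bounds. Arbitrary sequences outside the shift get the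
    value 0, so that every factor of the product is compact.\<close>
  define K where "K = Pi\<^sub>E UNIV (\<lambda>x. if x \<in> ?X then {1 / D x..C x} else {0})"
  define E where "E x = {h. ruelle A \<phi> h x = r * h x}" for x
  define R where "R = {h. oscillation_bounded A \<phi> h}"
  have "compactin (product_topology (\<lambda>_. euclideanreal) UNIV) K"
    unfolding K_def by (auto simp: compactin_PiE)
  then have "compact K" by (simp add: euclidean_product_topology)
  moreover have "closed R"
  proof -
    have "R = (\<Inter>m\<in>{1..}. \<Inter>x\<in>?X. \<Inter>y\<in>{y \<in> ?X. \<forall>i<m. x i = y i}.
        {h. h x \<le> exp (variation_tail A \<phi> m) * h y})"
      by (auto simp: R_def oscillation_bounded_def)
    then show ?thesis
      by (simp only:) (intro closed_INT ballI closed_Collect_le continuous_intros continuous_on_product_coordinates)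
  qed
  ultimately have "compact (K \<inter> R)" by (rule compact_Int_closed)
  then have "(K \<inter> R) \<inter> \<Inter>(E ` ?X) \<noteq> {}"
  proof (rule compact_imp_fip)
    fix T assume "T \<in> E ` ?X"
    then obtain x where x: "x \<in> ?X" "T = E x" by blast
    \<comment> \<open>At a fixed point the eigenvalue equation relates finitely many coordinates of
      \<open>h\<close> linearly, so it is closed in the product topology.\<close>
    show "closed T"
      unfolding x(2) E_def ruelle_eq_sum[OF x(1) lc]
      by (intro closed_Collect_eq continuous_intros continuous_on_product_coordinates)
  next
    fix F assume "finite F" "F \<subseteq> E ` ?X"
    then obtain Y where Y: "finite Y" "Y \<subseteq> ?X" "F = E ` Y" by (meson finite_subset_image)
    \<comment> \<open>Finitely many points use finitely many first states, and the state space is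
      infinite; the Green function of the cylinder of this \<open>a\<close> is harmonic at all
      points of \<open>Y\<close>.\<close>
    obtain a where a: "a \<notin> (\<lambda>x. x 0) ` Y"
      using assms(2) Y(1) by (metis ex_new_if_finite finite_imageI)
    obtain g where g: "superharmonic A r \<phi> g" "oscillation_bounded A \<phi> g" "g z = 1"
        "\<And>x. x \<in> ?X \<Longrightarrow> x 0 \<noteq> a \<Longrightarrow> ruelle A \<phi> g x = r * g x"
      using exists_normalized_superharmonic[OF assms(4-8) z, of a] by blast
    \<comment> \<open>Setting \<open>g\<close> to 0 off the shift places it in \<open>K\<close>; the
      operator evaluates its argument only on the shift, so its values do not change.\<close>
    define h where "h x = (if x \<in> ?X then g x else 0)" for x
    have "h \<in> K"
      using C D g by (force simp: K_def h_def field_simps)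
    moreover have "h \<in> R"
      using g(2) by (simp add: R_def h_def oscillation_bounded_def)
    moreover have "ruelle A \<phi> h x = ruelle A \<phi> g x" for x
      unfolding ruelle_def by (rule infsum_cong) (simp add: h_def)
    then have "h \<in> E x" if "x \<in> Y" for x
      using that Y(2) a g(4)[of x] by (auto simp: E_def h_def)
    ultimately show "(K \<inter> R) \<inter> \<Inter>F \<noteq> {}" using Y(3) by blast
  qed
  then obtain h where h: "h \<in> K" "h \<in> R" "\<And>x. x \<in> ?X \<Longrightarrow> h \<in> E x" by auto
  have "0 < h x" if "x \<in> ?X" for x
  proof -
    have "0 < 1 / D x" using D(1)[OF that] by simp
    also have "1 / D x \<le> h x"
      using PiE_mem[OF h(1)[unfolded K_def], of x] that by simp
    finally show ?thesis .
  qed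
  moreover have "continuous_map (shift_topology A) euclideanreal h"
    using continuous_map_oscillation_bounded[OF assms(7)] h(2) by (simp add: R_def)
  ultimately show ?thesis using h(3) by (auto simp: E_def)
qed

end
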